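(* For every integer $n \ge 9$, we have $rd_o(n) > rd_e(n)$, where $rd_o(n)$ denotes the number of partitions with perimeter $n$ into distinct parts having more odd parts than even parts, and $rd_e(n)$ denotes the number of partitions with perimeter $n$ into distinct parts having more even parts than odd parts.
   Context: A partition is a finite nonempty sequence of positive integers $\pi = (\pi_1, \pi_2, \ldots, \pi_r)$ with $\pi_1 \ge \pi_2 \ge \cdots \ge \pi_r$; the $\pi_i$ are its parts. It has distinct parts if $\pi_1 > \pi_2 > \cdots > \pi_r$. The Young diagram of $\pi$ is the left-justified array of boxes whose $i$-th row from the top contains $\pi_i$ boxes. The hook length of a box is the number of boxes directly to its right, plus the number of boxes directly below it, plus $1$. The perimeter of $\pi$ is the largest hook length of $\pi$; equivalently, it equals $\pi_1 + r - 1$ (largest part plus number of parts minus one). The partitions counted by $rd_o(n)$ and $rd_e(n)$ are those with perimeter equal to $n$; the sum of the parts is not fixed. *)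

theory Defs
  imports Main
begin

definition is_partition :: "nat list \<Rightarrow> bool" where
  "is_partition p \<longleftrightarrow> p \<noteq> [] \<and> (\<forall>x\<in>set p. 0 < x) \<and> sorted_wrt (\<ge>) p"

definition distinct_parts :: "nat list \<Rightarrow> bool" where
  "distinct_parts p \<longleftrightarrow> sorted_wrt (>) p"

(* Boxes are (row, column), both counted from 0. *)
definition young_diagram :: "nat list \<Rightarrow> (nat \<times> nat) set" where
  "young_diagram p = {(i, j). i < length p \<and> j < p ! i}"

definition hook_length :: "nat list \<Rightarrow> nat \<times> nat \<Rightarrow> nat" where
  "hook_length p = (\<lambda>(i, j).
     card {j'. j < j' \<and> (i, j') \<in> young_diagram p} +
     card {i'. i < i' \<and> (i', j) \<in> young_diagram p} + 1)"

definition perimeter :: "nat list \<Rightarrow> nat" where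
  "perimeter p = Max (hook_length p ` young_diagram p)"

definition num_odd_parts :: "nat list \<Rightarrow> nat" where
  "num_odd_parts p = length (filter odd p)"

definition num_even_parts :: "nat list \<Rightarrow> nat" where
  "num_even_parts p = length (filter even p)"

definition distinct_partitions_perimeter :: "nat \<Rightarrow> nat list set" where
  "distinct_partitions_perimeter n =
     {p. is_partition p \<and> distinct_parts p \<and> perimeter p = n}"

definition rd_o :: "nat \<Rightarrow> nat" where
  "rd_o n = card {p \<in> distinct_partitions_perimeter n. num_odd_parts p > num_even_parts p}"

definition rd_e :: "nat \<Rightarrow> nat" where
  "rd_e n = card {p \<in> distinct_partitions_perimeter n. num_even_parts p > num_odd_parts p}"

lemma perimeter_eq:
  assumes "is_partition p"
  shows "perimeter p = hd p + length p - 1"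
proof -
  obtain a q where p: "p = a # q" using assms by (cases p) (auto simp: is_partition_def)
  have pos: "\<And>i. i < length p \<Longrightarrow> 0 < p ! i"
    using assms by (auto simp: is_partition_def)
  have le: "\<And>i. i < length p \<Longrightarrow> p ! i \<le> a"
    using assms unfolding is_partition_def p by (auto simp: nth_Cons split: nat.splits)
  have fin: "finite (young_diagram p)"
    by (rule finite_subset[of _ "{..<length p} \<times> {..<a}"])
       (use le in \<open>auto simp: young_diagram_def intro: less_le_trans\<close>)
  have corner: "(0, 0) \<in> young_diagram p"
    using pos[of 0] by (auto simp: young_diagram_def p)
  have hcorner: "hook_length p (0, 0) = a + length p - 1"
  proof -
    have "{j'. 0 < j' \<and> (0, j') \<in> young_diagram p} = {0<..<a}"
      by (auto simp: young_diagram_def p)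
    moreover have "{i'. 0 < i' \<and> (i', 0) \<in> young_diagram p} = {0<..<length p}"
      using pos by (auto simp: young_diagram_def)
    ultimately show ?thesis using pos[of 0] by (simp add: hook_length_def p)
  qed
  have "hook_length p b \<le> a + length p - 1" if "b \<in> young_diagram p" for b
  proof -
    obtain i j where b: "b = (i, j)" by (cases b)
    with that have ij: "i < length p" "j < p ! i" by (auto simp: young_diagram_def)
    have "{j'. j < j' \<and> (i, j') \<in> young_diagram p} \<subseteq> {0<..<a}"
      using le[of i] by (auto simp: young_diagram_def)
    then have "card {j'. j < j' \<and> (i, j') \<in> young_diagram p} \<le> a - 1"
      using card_mono[of "{0<..<a}"] by fastforce
    moreover have "{i'. i < i' \<and> (i', j) \<in> young_diagram p} \<subseteq> {0<..<length p}"
      by (auto simp: young_diagram_def)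
    then have "card {i'. i < i' \<and> (i', j) \<in> young_diagram p} \<le> length p - 1"
      using card_mono[of "{0<..<length p}"] by fastforce
    ultimately show ?thesis using pos[of 0] by (simp add: hook_length_def b p)
  qed
  then show ?thesis
    unfolding perimeter_def
    using fin corner hcorner by (intro Max_eqI) (auto simp: p intro!: image_eqI[of _ _ "(0,0)"])
qed

lemma finite_distinct_partitions_perimeter: "finite (distinct_partitions_perimeter n)"
proof (rule finite_subset)
  show "distinct_partitions_perimeter n \<subseteq> {p. set p \<subseteq> {..n} \<and> length p \<le> n}"
  proof
    fix p assume "p \<in> distinct_partitions_perimeter n"
    then have ip: "is_partition p" and "perimeter p = n"
      by (auto simp: distinct_partitions_perimeter_def)
    then have n: "hd p + length p - 1 = n" by (simp add: perimeter_eq)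
    obtain a q where p: "p = a # q" using ip by (cases p) (auto simp: is_partition_def)
    show "p \<in> {p. set p \<subseteq> {..n} \<and> length p \<le> n}"
      using ip n unfolding p is_partition_def by auto
  qed
  show "finite {p. set p \<subseteq> {..n} \<and> length p \<le> n}"
    by (rule finite_lists_length_le) simp
qed

end

theory Submission
  imports Defs
begin

text \<open>
  Give a part weight \<open>1\<close> if it is odd and \<open>-1\<close> if it is even, and call the sum of the weights
  of the parts the balance. A partition into distinct parts with perimeter \<open>n\<close> is a largest part
  \<open>b + 1\<close> followed by \<open>n - 1 - b\<close> distinct parts from \<open>{1..b}\<close>. For \<open>b = 2m\<close> the balance of
  the remaining parts is distributed symmetrically around \<open>0\<close>, and almost everything cancels in the
  sum of the signs of the balances: what remains is \<open>A (n - 1) - A (n - 2)\<close>, where \<open>A N\<close> counts the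
  pairs of \<open>m\<close> and \<open>S \<subseteq> {1..2m}\<close> with \<open>2m + |S| = N\<close> and balance \<open>0\<close> or \<open>1\<close>.

  Reading \<open>S\<close> through the pairs \<open>{2i + 1, 2i + 2}\<close> turns these sets into lattice walks of total
  length \<open>N\<close> with flat steps of lengths \<open>2\<close> and \<open>4\<close> and with up and down steps of length \<open>3\<close>;
  the balance is the final height, which has the parity of \<open>N\<close>. If \<open>W N k\<close> is the number of
  walks of length \<open>N\<close> ending at height \<open>k\<close>, then expanding the last steps gives
  \<open>W (2K+1) 1 - W (2K) 0 = W (2K-5) 1 + W (2K-4) 2 + W (2K-2) 2\<close> for \<open>K \<ge> 1\<close>,
  and together with \<open>W N 2 \<le> W N 0\<close> it also gives \<open>W (2K+2) 0 > W (2K+1) 1\<close> for \<open>K \<ge> 2\<close>.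
\<close>

section \<open>Signed counts of decreasing lists\<close>

definition weight :: "nat \<Rightarrow> int" where
  "weight x = (if odd x then 1 else -1)"

definition balance :: "nat list \<Rightarrow> int" where
  "balance q = (\<Sum>x\<leftarrow>q. weight x)"

text \<open>The length is an integer so that the recursion below has no boundary cases.\<close>

definition strict_lists :: "nat \<Rightarrow> int \<Rightarrow> nat list set" where
  "strict_lists a s = {q. sorted_wrt (>) q \<and> set q \<subseteq> {1..a} \<and> int (length q) = s}"

definition balance_sum :: "nat \<Rightarrow> int \<Rightarrow> (int \<Rightarrow> int) \<Rightarrow> int" where
  "balance_sum a s h = (\<Sum>q\<in>strict_lists a s. h (balance q))"

lemma balance_Nil [simp]: "balance [] = 0"
  and balance_Cons [simp]: "balance (x # q) = weight x + balance q"
  by (simp_all add: balance_def)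

lemma balance_eq: "balance q = int (num_odd_parts q) - int (num_even_parts q)"
  by (induction q) (auto simp: weight_def num_odd_parts_def num_even_parts_def)

lemma length_strict_list_le:
  assumes "sorted_wrt (>) q" "set q \<subseteq> {1..a::nat}"
  shows "length q \<le> a"
proof -
  have "distinct q"
    using assms(1) by (induction q) auto
  then have "length q = card (set q)"
    by (simp add: distinct_card)
  also have "\<dots> \<le> card {1..a}"
    using assms(2) by (intro card_mono) auto
  finally show ?thesis by simp
qed

lemma finite_strict_lists: "finite (strict_lists a s)"
proof (rule finite_subset)
  show "strict_lists a s \<subseteq> {q. set q \<subseteq> {1..a} \<and> length q \<le> a}"
    unfolding strict_lists_def using length_strict_list_le by blast
qed (simp add: finite_lists_length_le)

lemma strict_lists_0: "strict_lists 0 s = (if s = 0 then {[]} else {})"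
  by (auto simp: strict_lists_def)

lemma strict_lists_neg: "s < 0 \<Longrightarrow> strict_lists a s = {}"
  by (auto simp: strict_lists_def)

lemma Cons_in_strict_lists_iff:
  "x # q \<in> strict_lists a s \<longleftrightarrow> 0 < x \<and> x \<le> a \<and> q \<in> strict_lists (x - 1) (s - 1)"
  by (cases x) (auto simp: strict_lists_def subset_iff Suc_le_eq less_Suc_eq_le)

lemma strict_lists_Suc:
  "strict_lists (Suc a) s = strict_lists a s \<union> (#) (Suc a) ` strict_lists a (s - 1)"
proof (rule set_eqI)
  fix q
  show "q \<in> strict_lists (Suc a) s \<longleftrightarrow>
      q \<in> strict_lists a s \<union> (#) (Suc a) ` strict_lists a (s - 1)"
  proof (cases q)
    case Nil
    then show ?thesis by (auto simp: strict_lists_def)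
  next
    case (Cons x r)
    then show ?thesis by (auto simp: Cons_in_strict_lists_iff le_Suc_eq)
  qed
qed

lemma balance_sum_0: "balance_sum 0 s h = (if s = 0 then h 0 else 0)"
  by (simp add: balance_sum_def strict_lists_0)

lemma balance_sum_neg: "s < 0 \<Longrightarrow> balance_sum a s h = 0"
  by (simp add: balance_sum_def strict_lists_neg)

lemma balance_sum_Suc:
  "balance_sum (Suc a) s h =
     balance_sum a s h + balance_sum a (s - 1) (\<lambda>d. h (weight (Suc a) + d))"
proof -
  have "strict_lists a s \<inter> (#) (Suc a) ` strict_lists a (s - 1) = {}"
    using Cons_in_strict_lists_iff[of "Suc a"] by force
  then show ?thesis
    by (simp add: balance_sum_def strict_lists_Suc finite_strict_lists sum.union_disjoint
        sum.reindex)
qed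

lemma balance_sum_add:
  "balance_sum a s (\<lambda>d. f d + g d) = balance_sum a s f + balance_sum a s g"
  by (simp add: balance_sum_def sum.distrib)

lemma balance_sum_uminus: "balance_sum a s (\<lambda>d. - f d) = - balance_sum a s f"
  by (simp add: balance_sum_def sum_negf)

text \<open>A list uses neither or both of \<open>2 * m + 1\<close> and \<open>2 * m + 2\<close>,
  whose weights cancel, or exactly one of them.\<close>

lemma balance_sum_double_Suc:
  "balance_sum (2 * Suc m) s h =
     balance_sum (2 * m) s h + balance_sum (2 * m) (s - 2) h +
     balance_sum (2 * m) (s - 1) (\<lambda>d. h (d + 1)) + balance_sum (2 * m) (s - 1) (\<lambda>d. h (d - 1))"
  by (simp add: balance_sum_Suc weight_def algebra_simps)

text \<open>Exchanging \<open>2 * i + 1\<close> and \<open>2 * i + 2\<close> in every pair negates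
  the balance and keeps the length.\<close>

lemma balance_sum_reflect:
  "balance_sum (2 * m) s (\<lambda>d. h (- d)) = balance_sum (2 * m) s h"
proof (induction m arbitrary: s h)
  case 0
  then show ?case by (simp add: balance_sum_0)
next
  case (Suc m)
  have "balance_sum (2 * m) s (\<lambda>d. h (- (d + c))) = balance_sum (2 * m) s (\<lambda>d. h (d - c))"
    for s c
    using Suc[of s "\<lambda>d. h (d - c)"] by simp
  from this[of "s - 1" 1] this[of "s - 1" "-1"] show ?case
    using Suc[of s h] Suc[of "s - 2" h] unfolding balance_sum_double_Suc by simp
qed

definition delta01 :: "int \<Rightarrow> int" where
  "delta01 d = of_bool (d = 0) + of_bool (d = 1)"

lemma balance_sum_sgn: "balance_sum (2 * m) s sgn = 0"
  using balance_sum_reflect[of m s sgn] by (simp add: balance_sum_uminus)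

text \<open>Averaging \<open>sgn (d + 1)\<close> over \<open>d\<close> and \<open>-d\<close> leaves only \<open>d \<in> {-1, 0, 1}\<close>.\<close>

lemma balance_sum_sgn_Suc:
  "balance_sum (2 * m) s (\<lambda>d. sgn (d + 1)) = balance_sum (2 * m) s delta01"
proof -
  let ?S = "balance_sum (2 * m) s"
  have "?S (\<lambda>d. sgn (d + 1)) + ?S (\<lambda>d. sgn (- d + 1)) =
      ?S (\<lambda>d. delta01 d + delta01 (- d))"
    unfolding balance_sum_add[symmetric]
    by (rule arg_cong[where f = ?S]) (auto simp: fun_eq_iff delta01_def sgn_if)
  then show ?thesis
    using balance_sum_reflect[of m s "\<lambda>d. sgn (d + 1)"] balance_sum_reflect[of m s delta01]
    by (simp add: balance_sum_add)
qed

lemma balance_sum_sgn_diff_1: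
  "balance_sum (2 * m) s (\<lambda>d. sgn (d - 1)) = - balance_sum (2 * m) s delta01"
proof -
  have "(\<lambda>d::int. sgn (- d - 1)) = (\<lambda>d. - sgn (d + 1))"
    by (auto simp: fun_eq_iff sgn_if)
  then show ?thesis
    using balance_sum_reflect[of m s "\<lambda>d. sgn (d - 1)"]
    by (simp add: balance_sum_uminus balance_sum_sgn_Suc)
qed

section \<open>Lattice walks\<close>

definition walk_sum :: "int \<Rightarrow> (int \<Rightarrow> int) \<Rightarrow> int" where
  "walk_sum N h = (\<Sum>m<nat (N + 1). balance_sum (2 * m) (N - 2 * int m) h)"

definition walks :: "int \<Rightarrow> int \<Rightarrow> int" where
  "walks N k = walk_sum N (\<lambda>d. of_bool (d = k))"

text \<open>Terms with \<open>2 * m > N\<close> vanish, as no list has negative length.\<close>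

lemma walk_sum_eq:
  assumes "N < int M"
  shows "(\<Sum>m<M. balance_sum (2 * m) (N - 2 * int m) h) = walk_sum N h"
  unfolding walk_sum_def using assms
  by (intro sum.mono_neutral_right) (auto simp: balance_sum_neg)

lemma walk_sum_neg: "N < 0 \<Longrightarrow> walk_sum N h = 0"
  by (simp add: walk_sum_def)

text \<open>The term \<open>m = 0\<close> is the empty walk; for \<open>m > 0\<close> the last pair
  contributes length 2, plus 1 for each of its chosen elements.\<close>

lemma walk_sum_rec:
  "walk_sum N h = (if N = 0 then h 0 else 0) + walk_sum (N - 2) h + walk_sum (N - 4) h +
     walk_sum (N - 3) (\<lambda>d. h (d + 1)) + walk_sum (N - 3) (\<lambda>d. h (d - 1))"
proof -
  define M where "M = nat (N + 1)"
  have M: "N < int M" unfolding M_def by simp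
  have shift: "N - 2 * int (Suc m) = N - 2 - 2 * int m"
    "N - 2 - 2 * int m - 2 = N - 4 - 2 * int m"
    "N - 2 - 2 * int m - 1 = N - 3 - 2 * int m" for m
    by simp_all
  have "walk_sum N h = (\<Sum>m<Suc M. balance_sum (2 * m) (N - 2 * int m) h)"
    using M by (intro walk_sum_eq[symmetric]) simp
  also have "\<dots> = balance_sum 0 N h +
      (\<Sum>m<M. balance_sum (2 * Suc m) (N - 2 * int (Suc m)) h)"
    by (subst sum.lessThan_Suc_shift) simp
  moreover have "(\<Sum>m<M. balance_sum (2 * m) (N - 2 - 2 * int m) g) = walk_sum (N - 2) g"
    "(\<Sum>m<M. balance_sum (2 * m) (N - 3 - 2 * int m) g) = walk_sum (N - 3) g"
    "(\<Sum>m<M. balance_sum (2 * m) (N - 4 - 2 * int m) g) = walk_sum (N - 4) g" for g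
    using M by (auto intro!: walk_sum_eq)
  ultimately show ?thesis
    unfolding balance_sum_double_Suc shift sum.distrib by (simp only: balance_sum_0)
qed

lemma walks_neg: "N < 0 \<Longrightarrow> walks N k = 0"
  by (simp add: walks_def walk_sum_neg)

lemma walks_rec:
  "walks N k = of_bool (N = 0 \<and> k = 0) + walks (N - 2) k + walks (N - 4) k +
     walks (N - 3) (k - 1) + walks (N - 3) (k + 1)"
proof -
  have "(d + 1 = k) = (d = k - 1)" "(d - 1 = k) = (d = k + 1)" for d
    by auto
  then show ?thesis
    unfolding walks_def by (subst walk_sum_rec) simp
qed

lemma walks_nonneg: "walks N k \<ge> 0"
  by (auto simp: walks_def walk_sum_def balance_sum_def intro!: sum_nonneg)

lemma walks_uminus: "walks N (- k) = walks N k"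
proof -
  have "(\<lambda>d. of_bool (d = - k)) = (\<lambda>d. of_bool (- d = k) :: int)"
    by (auto simp: fun_eq_iff)
  then show ?thesis
    using balance_sum_reflect[of _ _ "\<lambda>d. of_bool (d = k)"]
    by (simp add: walks_def walk_sum_def)
qed

text \<open>Every step changes length plus height by an even amount.\<close>

lemma walks_parity: "odd (N + k) \<Longrightarrow> walks N k = 0"
proof (induction "nat (N + 1)" arbitrary: N k rule: less_induct)
  case less
  show ?case
  proof (cases "N < 0")
    case False
    then show ?thesis
      using less by (subst walks_rec) auto
  qed (simp add: walks_neg)
qed

text \<open>At \<open>k = -1\<close> reflection gives equality; including this value keeps
  \<open>k - 1\<close> within the induction hypothesis when \<open>k = 0\<close>.\<close>

lemma walks_height_decreasing:
  assumes "k \<ge> -1"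
  shows "walks N (k + 2) \<le> walks N k"
  using assms
proof (induction "nat (N + 1)" arbitrary: N k rule: less_induct)
  case less
  consider "N < 0" | "k = -1" | "N \<ge> 0" "k \<ge> 0"
    using less.prems by linarith
  then show ?case
  proof cases
    case 1
    then show ?thesis by (simp add: walks_neg)
  next
    case 2
    then show ?thesis using walks_uminus[of N 1] by simp
  next
    case 3
    have "walks (N - 2) (k + 2) \<le> walks (N - 2) k"
      "walks (N - 4) (k + 2) \<le> walks (N - 4) k"
      "walks (N - 3) (k + 1) \<le> walks (N - 3) (k - 1)"
      "walks (N - 3) (k + 3) \<le> walks (N - 3) (k + 1)"
      using 3 less.hyps[of "N - 2" k] less.hyps[of "N - 4" k] less.hyps[of "N - 3" "k - 1"]
        less.hyps[of "N - 3" "k + 1"] by (simp_all add: add.commute)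
    with 3 show ?thesis
      using walks_rec[of N k] walks_rec[of N "k + 2"] by (simp add: walks_neg algebra_simps)
  qed
qed

section \<open>Growth of the walk counts\<close>

lemma walks_0_0: "walks 0 0 = 1"
  by (subst walks_rec) (simp add: walks_neg)

lemma walks_0_pos: "walks (2 * int K) 0 > 0"
proof (induction K)
  case (Suc K)
  then show ?case
    using walks_rec[of "2 * int (Suc K)" 0] walks_nonneg[of "2 * int (Suc K) - 4" 0]
      walks_nonneg[of "2 * int (Suc K) - 3" "-1"] walks_nonneg[of "2 * int (Suc K) - 3" 1]
    by simp
qed (simp add: walks_0_0)

lemma walks_1_pos: "walks (2 * int K + 3) 1 > 0"
  using walks_rec[of "2 * int K + 3" 1] walks_nonneg[of "2 * int K + 1" 1]
    walks_nonneg[of "2 * int K - 1" 1] walks_nonneg[of "2 * int K" 2] walks_0_pos[of K]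
  by (simp add: add.commute)

lemma walks_0_less_walks_1:
  assumes "K \<ge> 4"
  shows "walks (2 * int K) 0 < walks (2 * int K + 1) 1"
proof -
  define x where "x = 2 * int K"
  \<comment> \<open>This term makes the difference positive; \<open>x - 5 = 2 * (K - 4) + 3\<close>
    explains \<open>K \<ge> 4\<close>.\<close>
  have pos: "walks (x - 5) 1 > 0"
    using walks_1_pos[of "K - 4"] assms by (simp add: x_def)
  have "walks (x + 1) 1 = walks (x - 1) 1 + walks (x - 3) 1 + walks (x - 2) 0 + walks (x - 2) 2"
    using walks_rec[of "x + 1" 1] by simp
  moreover have "walks x 0 = walks (x - 2) 0 + walks (x - 4) 0 + 2 * walks (x - 3) 1"
    using walks_rec[of x 0] walks_uminus[of _ 1] assms by (simp add: x_def)
  moreover have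
    "walks (x - 1) 1 = walks (x - 3) 1 + walks (x - 5) 1 + walks (x - 4) 0 + walks (x - 4) 2"
    using walks_rec[of "x - 1" 1] by simp
  ultimately show ?thesis
    unfolding x_def[symmetric] using pos walks_nonneg[of "x - 4" 2] walks_nonneg[of "x - 2" 2]
    by linarith
qed

lemma walks_1_less_walks_0:
  assumes "K \<ge> 2"
  shows "walks (2 * int K + 1) 1 < walks (2 * int K + 2) 0"
proof -
  define x where "x = 2 * int K"
  have pos: "walks (x - 4) 0 > 0"
    using walks_0_pos[of "K - 2"] assms by (simp add: x_def)
  have "walks (x + 2) 0 = walks x 0 + walks (x - 2) 0 + 2 * walks (x - 1) 1"
    using walks_rec[of "x + 2" 0] walks_uminus[of _ 1] assms by (simp add: x_def)
  moreover have
    "walks (x + 1) 1 = walks (x - 1) 1 + walks (x - 3) 1 + walks (x - 2) 0 + walks (x - 2) 2"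
    using walks_rec[of "x + 1" 1] by simp
  moreover have "walks x 0 = walks (x - 2) 0 + walks (x - 4) 0 + 2 * walks (x - 3) 1"
    using walks_rec[of x 0] walks_uminus[of _ 1] assms by (simp add: x_def)
  moreover have "walks (x - 2) 2 \<le> walks (x - 2) 0"
    using walks_height_decreasing[of 0 "x - 2"] by simp
  \<comment> \<open>The difference is \<open>walks (x - 2) 0 - walks (x - 2) 2 + walks (x - 4) 0 +
    walks (x - 3) 1 + walks (x - 1) 1\<close>.\<close>
  ultimately show ?thesis
    unfolding x_def[symmetric]
    using pos walks_nonneg[of "x - 1" 1] walks_nonneg[of "x - 3" 1]
    by linarith
qed

lemma walk_sum_delta01: "walk_sum N delta01 = walks N 0 + walks N 1"
  unfolding walks_def walk_sum_def sum.distrib[symmetric] balance_sum_add[symmetric]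
  by (simp add: delta01_def[abs_def])

text \<open>By parity only one of the heights 0 and 1 contributes at each length. An even
  \<open>N \<ge> 7\<close> is at least 8, which gives \<open>K \<ge> 4\<close>.\<close>

lemma walk_sum_delta01_less:
  assumes "N \<ge> 7"
  shows "walk_sum (int N) delta01 < walk_sum (int N + 1) delta01"
proof (cases "even N")
  case True
  then obtain K where "N = 2 * K" by (elim evenE)
  then show ?thesis
    using walks_0_less_walks_1[of K] assms by (simp add: walk_sum_delta01 walks_parity)
next
  case False
  then obtain K where "N = 2 * K + 1" by (elim oddE)
  then show ?thesis
    using walks_1_less_walks_0[of K] assms by (simp add: walk_sum_delta01 walks_parity add.commute)
qed

section \<open>From partitions to walks\<close>

lemma distinct_partitions_perimeter_eq:
  "distinct_partitions_perimeter n =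
     (\<Union>b<2 * n. (#) (Suc b) ` strict_lists b (int n - 1 - int b))" (is "_ = ?R")
proof (intro equalityI subsetI)
  fix p assume "p \<in> distinct_partitions_perimeter n"
  then have p: "is_partition p" "sorted_wrt (>) p" "hd p + length p - 1 = n"
    by (auto simp: distinct_partitions_perimeter_def distinct_parts_def perimeter_eq)
  then obtain b q where b: "p = Suc b # q"
    by (cases p) (auto simp: is_partition_def gr0_conv_Suc)
  with p have "q \<in> strict_lists b (int n - 1 - int b)"
    by (auto simp: strict_lists_def is_partition_def Suc_le_eq less_Suc_eq_le)
  \<comment> \<open>In fact \<open>b < n\<close>; the range up to \<open>2 * n\<close> lets the
    later sum split into pairs \<open>2 * m\<close>, \<open>Suc (2 * m)\<close>.\<close>
  moreover have "b < 2 * n" using p b by simp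
  ultimately show "p \<in> ?R" using b by auto
next
  fix p assume "p \<in> ?R"
  then obtain b q where b: "p = Suc b # q" "q \<in> strict_lists b (int n - 1 - int b)"
    by auto
  then have q: "sorted_wrt (>) q" "set q \<subseteq> {1..b}" "b + length q + 1 = n"
    by (auto simp: strict_lists_def)
  have "sorted_wrt (>) p"
    unfolding b(1) using q by auto
  moreover from this have "sorted_wrt (\<ge>) p"
    by (rule sorted_wrt_mono_rel[rotated]) simp
  then have "is_partition p"
    using q b by (auto simp: is_partition_def)
  ultimately show "p \<in> distinct_partitions_perimeter n"
    using q b by (simp add: distinct_partitions_perimeter_def distinct_parts_def perimeter_eq)
qed

lemma rd_diff_eq_sum_sgn:
  "int (rd_o n) - int (rd_e n) = (\<Sum>p\<in>distinct_partitions_perimeter n. sgn (balance p))"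
proof -
  let ?P = "distinct_partitions_perimeter n"
  have "(\<Sum>p\<in>?P. sgn (balance p)) =
      (\<Sum>p\<in>?P. of_bool (num_odd_parts p > num_even_parts p) -
                of_bool (num_even_parts p > num_odd_parts p))"
    by (intro sum.cong) (auto simp: balance_eq sgn_if)
  then show ?thesis
    by (simp add: rd_o_def rd_e_def sum_subtractf finite_distinct_partitions_perimeter
        sum.If_cases of_bool_def Int_def)
qed

lemma sum_lessThan_double:
  "(\<Sum>b<2 * M. f b) = (\<Sum>m<M. f (2 * m) + f (Suc (2 * m)))" for f :: "nat \<Rightarrow> int"
  by (induction M) simp_all

lemma rd_diff_eq_walk_sum:
  "int (rd_o n) - int (rd_e n) = walk_sum (int n - 1) delta01 - walk_sum (int n - 2) delta01"
proof -
  have "int (rd_o n) - int (rd_e n) =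
      (\<Sum>b<2 * n. \<Sum>p\<in>(#) (Suc b) ` strict_lists b (int n - 1 - int b). sgn (balance p))"
    unfolding rd_diff_eq_sum_sgn distinct_partitions_perimeter_eq
    by (rule sum.UNION_disjoint) (auto simp: finite_strict_lists)
  also have "\<dots> = (\<Sum>b<2 * n. balance_sum b (int n - 1 - int b) (\<lambda>d. sgn (weight (Suc b) + d)))"
    by (simp add: sum.reindex balance_sum_def)
  also have "\<dots> = (\<Sum>m<n. balance_sum (2 * m) (int n - 1 - 2 * int m) delta01 -
      balance_sum (2 * m) (int n - 2 - 2 * int m) delta01)"
    unfolding sum_lessThan_double
  proof (rule sum.cong)
    fix m
    have "balance_sum (2 * m) (int n - 1 - int (2 * m)) (\<lambda>d. sgn (weight (Suc (2 * m)) + d)) =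
        balance_sum (2 * m) (int n - 1 - 2 * int m) delta01"
      using balance_sum_sgn_Suc[of m] by (simp add: weight_def add.commute)
    \<comment> \<open>The largest part \<open>2 * m + 2\<close> is even. If \<open>2 * m + 1\<close>
      also occurs, the two weights cancel and \<open>balance_sum_sgn\<close> gives 0.\<close>
    moreover have "balance_sum (Suc (2 * m)) (int n - 1 - int (Suc (2 * m)))
          (\<lambda>d. sgn (weight (Suc (Suc (2 * m))) + d)) =
        - balance_sum (2 * m) (int n - 2 - 2 * int m) delta01"
      using balance_sum_sgn_diff_1[of m] balance_sum_sgn[of m]
      by (simp add: balance_sum_Suc weight_def algebra_simps)
    ultimately show "balance_sum (2 * m) (int n - 1 - int (2 * m))
          (\<lambda>d. sgn (weight (Suc (2 * m)) + d)) +
        balance_sum (Suc (2 * m)) (int n - 1 - int (Suc (2 * m)))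
          (\<lambda>d. sgn (weight (Suc (Suc (2 * m))) + d)) =
        balance_sum (2 * m) (int n - 1 - 2 * int m) delta01 -
        balance_sum (2 * m) (int n - 2 - 2 * int m) delta01"
      by simp
  qed simp
  also have "\<dots> = walk_sum (int n - 1) delta01 - walk_sum (int n - 2) delta01"
    by (simp add: sum_subtractf walk_sum_eq)
  finally show ?thesis .
qed

theorem theorem1p3:
  fixes n :: nat
  assumes "n \<ge> 9"
  shows "rd_o n > rd_e n"
proof -
  have "walk_sum (int n - 2) delta01 < walk_sum (int n - 1) delta01"
    using walk_sum_delta01_less[of "n - 2"] assms by simp
  then show ?thesis
    using rd_diff_eq_walk_sum[of n] by linarith
qed

end
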